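(* There is a constant $C>0$ such that for all integers $k\ge 2$ and all positive integers $n,m$, $$nm-2\sqrt{2}\sqrt{nm}-C(\sqrt{n}+\sqrt{m})\ \le\ \mathrm{HB2}_k(n,m).$$
   Context: A two-dimensional partial word of size $n$ by $m$ over an alphabet $A$ is a map $w:\{0,\dots,n-1\}\times\{0,\dots,m-1\}\to A\cup\{\diamondsuit\}$, where $\diamondsuit\notin A$ is a hole; its domain $\mathrm{D}(w)$ is the set of positions $p$ with $w(p)\in A$. An $(n,m)$-ruler is a subset $R\subseteq\{0,\dots,n-1\}\times\{0,\dots,m-1\}$ such that every $(x,y)\in\mathbb{Z}^2$ with $|x|\le n-1$, $|y|\le m-1$ equals $r_1-r_2$ for some $r_1,r_2\in R$. The two-dimensional partial word $w$ is unbordered if $\mathrm{D}(w)$ is an $(n,m)$-ruler and for every nonzero vector $v$ with $|v_1|\le n-1$, $|v_2|\le m-1$ there exist $r_1,r_2\in\mathrm{D}(w)$ with $r_1-r_2=v$ and $w(r_1)\ne w(r_2)$. $\mathrm{HB2}_k(n,m)$ denotes the maximum number of holes an $n$ by $m$ unbordered two-dimensional partial word over an alphabet of size $k$ can have. *)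

theory Defs
  imports Complex_Main "HOL-Library.FuncSet" "HOL-Library.Product_Plus"
begin

definition grid :: "nat \<Rightarrow> nat \<Rightarrow> (int \<times> int) set" where
  "grid n m = {0..<int n} \<times> {0..<int m}"

text \<open>The hole is \<^const>\<open>None\<close>; a letter \<open>a\<close> of the alphabet is \<open>Some a\<close>.\<close>

definition partial_words :: "'a set \<Rightarrow> nat \<Rightarrow> nat \<Rightarrow> (int \<times> int \<Rightarrow> 'a option) set" where
  "partial_words A n m = grid n m \<rightarrow>\<^sub>E insert None (Some ` A)"

definition word_dom :: "nat \<Rightarrow> nat \<Rightarrow> (int \<times> int \<Rightarrow> 'a option) \<Rightarrow> (int \<times> int) set" where
  "word_dom n m w = {p \<in> grid n m. w p \<noteq> None}"

definition num_holes :: "nat \<Rightarrow> nat \<Rightarrow> (int \<times> int \<Rightarrow> 'a option) \<Rightarrow> nat" where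
  "num_holes n m w = card {p \<in> grid n m. w p = None}"

definition ruler :: "nat \<Rightarrow> nat \<Rightarrow> (int \<times> int) set \<Rightarrow> bool" where
  "ruler n m R \<longleftrightarrow> R \<subseteq> grid n m \<and>
     (\<forall>x y. \<bar>x\<bar> \<le> int n - 1 \<and> \<bar>y\<bar> \<le> int m - 1 \<longrightarrow>
        (\<exists>r1\<in>R. \<exists>r2\<in>R. (x, y) = r1 - r2))"

definition unbordered :: "nat \<Rightarrow> nat \<Rightarrow> (int \<times> int \<Rightarrow> 'a option) \<Rightarrow> bool" where
  "unbordered n m w \<longleftrightarrow> ruler n m (word_dom n m w) \<and>
     (\<forall>v. v \<noteq> 0 \<and> \<bar>fst v\<bar> \<le> int n - 1 \<and> \<bar>snd v\<bar> \<le> int m - 1 \<longrightarrow>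
        (\<exists>r1\<in>word_dom n m w. \<exists>r2\<in>word_dom n m w. r1 - r2 = v \<and> w r1 \<noteq> w r2))"

definition hole_counts :: "'a set \<Rightarrow> nat \<Rightarrow> nat \<Rightarrow> nat set" where
  "hole_counts A n m = {num_holes n m w | w. w \<in> partial_words A n m \<and> unbordered n m w}"

text \<open>
  The value depends only on the size of the alphabet (lemma \<open>HB2_alphabet\<close>), so a standard
  alphabet of size \<open>k\<close> is used.  If no unbordered word exists (as for
  \<open>k = n = m = 2\<close>), the maximum is over the empty set and is an unspecified natural number.
\<close>

definition HB2 :: "nat \<Rightarrow> nat \<Rightarrow> nat \<Rightarrow> nat" where
  "HB2 k n m = Max (hole_counts {..<k} n m)"

lemma finite_grid [simp]: "finite (grid n m)"
  by (simp add: grid_def)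

lemma finite_hole_counts: "finite (hole_counts A n m)"
proof (rule finite_subset)
  show "hole_counts A n m \<subseteq> {..card (grid n m)}"
    by (auto simp: hole_counts_def num_holes_def intro!: card_mono)
qed simp

lemma hole_counts_mono_bij:
  assumes "bij_betw f A B"
  shows "hole_counts A n m \<subseteq> hole_counts B n m"
proof
  fix h assume "h \<in> hole_counts A n m"
  then obtain w where w: "w \<in> partial_words A n m" "unbordered n m w" "h = num_holes n m w"
    by (auto simp: hole_counts_def)
  define w' where "w' = restrict (\<lambda>p. map_option f (w p)) (grid n m)"
  have inj: "inj_on f A" and img: "f ` A = B"
    using assms by (auto simp: bij_betw_def)
  have letter: "w p = None \<or> (\<exists>a\<in>A. w p = Some a)" if "p \<in> grid n m" for p
    using PiE_mem[OF w(1)[unfolded partial_words_def] that] by auto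
  have w': "w' p = map_option f (w p)" if "p \<in> grid n m" for p
    using that by (simp add: w'_def)
  have dom: "word_dom n m w' = word_dom n m w"
    by (auto simp: word_dom_def w')
  have neq: "w' p \<noteq> w' q"
    if pq: "p \<in> word_dom n m w" "q \<in> word_dom n m w" "w p \<noteq> w q" for p q
  proof -
    have g: "p \<in> grid n m" "q \<in> grid n m" "w p \<noteq> None" "w q \<noteq> None"
      using pq by (simp_all add: word_dom_def)
    obtain a b where "a \<in> A" "b \<in> A" "w p = Some a" "w q = Some b"
      using letter[OF g(1)] letter[OF g(2)] g(3,4) by blast
    then show ?thesis
      using pq(3) inj by (simp add: w'[OF g(1)] w'[OF g(2)] inj_on_eq_iff)
  qed
  have "w' \<in> partial_words B n m"
    unfolding partial_words_def
  proof (rule PiE_I)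
    fix p assume "p \<in> grid n m"
    then show "w' p \<in> insert None (Some ` B)"
      using letter[of p] img by (auto simp: w')
  qed (simp add: w'_def)
  moreover have "unbordered n m w'"
    unfolding unbordered_def dom
  proof (intro conjI allI impI)
    show "ruler n m (word_dom n m w)"
      using w(2) by (simp add: unbordered_def)
  next
    fix v :: "int \<times> int"
    assume "v \<noteq> 0 \<and> \<bar>fst v\<bar> \<le> int n - 1 \<and> \<bar>snd v\<bar> \<le> int m - 1"
    then obtain r1 r2 where r: "r1 \<in> word_dom n m w" "r2 \<in> word_dom n m w" "r1 - r2 = v" "w r1 \<noteq> w r2"
      using w(2) unfolding unbordered_def by blast
    show "\<exists>r1\<in>word_dom n m w. \<exists>r2\<in>word_dom n m w. r1 - r2 = v \<and> w' r1 \<noteq> w' r2"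
      using r(1-3) neq[OF r(1,2,4)] by blast
  qed
  moreover have "{p \<in> grid n m. w' p = None} = {p \<in> grid n m. w p = None}"
    by (auto simp: w')
  then have "h = num_holes n m w'"
    using w(3) by (simp add: num_holes_def)
  ultimately show "h \<in> hole_counts B n m"
    by (auto simp: hole_counts_def)
qed

lemma HB2_alphabet:
  assumes "finite A" "card A = k"
  shows "HB2 k n m = Max (hole_counts A n m)"
proof -
  obtain f where f: "bij_betw f A {..<k}"
    using assms finite_same_card_bij[of A "{..<k}"] by auto
  have "hole_counts A n m = hole_counts {..<k} n m"
    using hole_counts_mono_bij[OF f] hole_counts_mono_bij[OF bij_betw_inv_into[OF f]] by blast
  then show ?thesis
    by (simp add: HB2_def)
qed

end

theory Submission
  imports Defs "HOL-Library.Discrete_Functions"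
begin

text \<open>
  A word over two letters is unbordered once every nonzero vector of the box is, up to sign, a
  difference between a position in the set \<open>A\<close> of the first letter and a position in the set \<open>B\<close>
  of the second. There are about \<open>2nm\<close> vectors up to sign, and a product construction covers them
  almost without repetition. Let \<open>q \<approx> \<surd>(n/2)\<close> and \<open>p \<approx> \<surd>m\<close>. In the first coordinate, \<open>A\<close> uses the
  last \<open>q\<close> rows and \<open>B\<close> the multiples of \<open>q\<close>, so that all positive differences occur; in the second,
  \<open>A\<close> uses the first \<open>p\<close> and the last \<open>p\<close> columns and \<open>B\<close> the multiples of \<open>p\<close>, so that all
  differences of both signs occur. Both sets have about \<open>\<surd>2 \<surd>(nm)\<close> elements. The vectors
  \<open>(0, y)\<close> are treated separately inside a single unused row, at a cost of \<open>O(\<surd>m)\<close>.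
\<close>

section \<open>From difference covers to unbordered words\<close>

definition difference_cover :: "nat \<Rightarrow> nat \<Rightarrow> (int \<times> int) set \<Rightarrow> (int \<times> int) set \<Rightarrow> bool" where
  "difference_cover n m A B \<longleftrightarrow> A \<subseteq> grid n m \<and> B \<subseteq> grid n m \<and> A \<inter> B = {} \<and> A \<noteq> {} \<and>
     (\<forall>x y. (x, y) \<noteq> 0 \<and> \<bar>x\<bar> \<le> int n - 1 \<and> \<bar>y\<bar> \<le> int m - 1 \<longrightarrow>
        (\<exists>a\<in>A. \<exists>b\<in>B. a - b = (x, y) \<or> b - a = (x, y)))"

lemma card_grid [simp]: "card (grid n m) = n * m"
  by (simp add: grid_def card_cartesian_product)

text \<open>Writing letter 0 on \<open>A\<close>, letter 1 on \<open>B\<close> and holes elsewhere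
  gives an unbordered word: a pair realising \<open>v\<close> or \<open>- v\<close>, taken in the
  right order, has difference \<open>v\<close> and distinct letters.\<close>

lemma HB2_ge_of_difference_cover:
  assumes cov: "difference_cover n m A B" and k: "k \<ge> 2"
  shows "n * m \<le> HB2 k n m + card A + card B"
proof -
  define w :: "int \<times> int \<Rightarrow> nat option" where
    "w = restrict (\<lambda>p. if p \<in> A then Some 0 else if p \<in> B then Some 1 else None) (grid n m)"
  have sub: "A \<subseteq> grid n m" "B \<subseteq> grid n m" "A \<inter> B = {}" "A \<noteq> {}"
    using cov by (auto simp: difference_cover_def)
  have wA: "w a = Some 0" if "a \<in> A" for a
    using that sub by (auto simp: w_def)
  have wB: "w b = Some 1" if "b \<in> B" for b
    using that sub by (auto simp: w_def)
  have dom: "word_dom n m w = A \<union> B"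
    using sub by (auto simp: word_dom_def w_def split: if_splits)
  have word: "w \<in> partial_words {..<k} n m"
    using k by (auto simp: partial_words_def w_def)
  have sep: "\<exists>r1\<in>A \<union> B. \<exists>r2\<in>A \<union> B. r1 - r2 = v \<and> w r1 \<noteq> w r2"
    if "v \<noteq> 0 \<and> \<bar>fst v\<bar> \<le> int n - 1 \<and> \<bar>snd v\<bar> \<le> int m - 1" for v
  proof -
    obtain x y where v: "v = (x, y)" by (cases v)
    then have "(x, y) \<noteq> 0 \<and> \<bar>x\<bar> \<le> int n - 1 \<and> \<bar>y\<bar> \<le> int m - 1"
      using that by simp
    then obtain a b where ab: "a \<in> A" "b \<in> B" "a - b = v \<or> b - a = v"
      using cov unfolding difference_cover_def v by blast
    have "w a \<noteq> w b"
      using ab wA wB by simp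
    then show ?thesis
      using ab(1,2) ab(3) by (elim disjE) (blast intro: sym)+
  qed
  have "ruler n m (A \<union> B)"
    unfolding ruler_def
  proof (intro conjI allI impI)
    show "A \<union> B \<subseteq> grid n m"
      using sub by simp
    fix x y :: int assume xy: "\<bar>x\<bar> \<le> int n - 1 \<and> \<bar>y\<bar> \<le> int m - 1"
    show "\<exists>r1\<in>A \<union> B. \<exists>r2\<in>A \<union> B. (x, y) = r1 - r2"
    proof (cases "(x, y) = 0")
      case True
      \<comment> \<open>The cover only handles nonzero vectors; the zero vector of the ruler comes
        from \<open>A\<close> being nonempty.\<close>
      obtain a where "a \<in> A" using sub(4) by blast
      moreover have "(x, y) = a - a" using True by simp
      ultimately show ?thesis by blast
    next
      case False
      then have "\<exists>r1\<in>A \<union> B. \<exists>r2\<in>A \<union> B. r1 - r2 = (x, y) \<and> w r1 \<noteq> w r2"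
        using xy by (intro sep) simp
      then obtain r1 r2 where "r1 \<in> A \<union> B" "r2 \<in> A \<union> B" "r1 - r2 = (x, y)" by blast
      then show ?thesis by (intro bexI[of _ r1] bexI[of _ r2]) simp_all
    qed
  qed
  then have "unbordered n m w"
    unfolding unbordered_def dom using sep by (intro conjI allI impI) assumption+
  then have "num_holes n m w \<in> hole_counts {..<k} n m"
    unfolding hole_counts_def using word by (intro CollectI exI[of _ w] conjI refl)
  then have "num_holes n m w \<le> HB2 k n m"
    unfolding HB2_def by (rule Max_ge[OF finite_hole_counts])
  moreover have "{p \<in> grid n m. w p = None} = grid n m - (A \<union> B)"
    by (auto simp: w_def)
  then have "n * m - card (A \<union> B) \<le> num_holes n m w"
    unfolding num_holes_def using diff_card_le_card_Diff[of "A \<union> B" "grid n m"]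
      finite_subset[OF sub(1)] finite_subset[OF sub(2)] by simp
  ultimately show ?thesis
    using card_Un_le[of A B] by linarith
qed

text \<open>Transposition serves grids with few rows but many columns, since the construction below
  needs enough rows.\<close>

lemma difference_cover_swap:
  assumes "difference_cover n m A B"
  shows "difference_cover m n (prod.swap ` A) (prod.swap ` B)"
  unfolding difference_cover_def
proof (intro conjI allI impI)
  have sub: "A \<subseteq> grid n m" "B \<subseteq> grid n m" "A \<inter> B = {}" "A \<noteq> {}"
    using assms by (auto simp: difference_cover_def)
  show "prod.swap ` A \<subseteq> grid m n" "prod.swap ` B \<subseteq> grid m n" "prod.swap ` A \<noteq> {}"
    using sub by (auto simp: grid_def)
  show "prod.swap ` A \<inter> prod.swap ` B = {}"
    using sub(3) by auto
  fix x y :: int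
  assume xy: "(x, y) \<noteq> 0 \<and> \<bar>x\<bar> \<le> int m - 1 \<and> \<bar>y\<bar> \<le> int n - 1"
  then have "(y, x) \<noteq> 0"
    by (auto simp: zero_prod_def)
  then obtain a b where ab: "a \<in> A" "b \<in> B" "a - b = (y, x) \<or> b - a = (y, x)"
    using assms xy unfolding difference_cover_def by blast
  then have "prod.swap a - prod.swap b = (x, y) \<or> prod.swap b - prod.swap a = (x, y)"
    by (cases a, cases b) auto
  then show "\<exists>a\<in>prod.swap ` A. \<exists>b\<in>prod.swap ` B. a - b = (x, y) \<or> b - a = (x, y)"
    using ab by blast
qed

section \<open>Difference covers in one dimension\<close>

lemma multiple_in_window:
  fixes p t :: int
  assumes "p > 0"
  obtains c where "p dvd c" "t \<le> c" "c < t + p"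
proof
  \<comment> \<open>The witness is \<open>t\<close> rounded up to a multiple of \<open>p\<close>,
    the ceiling being a negated floor of \<open>- t\<close>.\<close>
  show "p dvd p * (- ((- t) div p))" by simp
  have "- t = p * ((- t) div p) + (- t) mod p" by simp
  moreover have "0 \<le> (- t) mod p" "(- t) mod p < p" using assms by simp_all
  ultimately show "t \<le> p * (- ((- t) div p))" "p * (- ((- t) div p)) < t + p"
    by (simp_all only: mult_minus_right)
qed

definition multiples :: "nat \<Rightarrow> nat \<Rightarrow> int set" where
  "multiples p N = {c. 0 \<le> c \<and> c < int N \<and> int p dvd c}"

lemma card_multiples_le:
  assumes "p > 0" shows "card (multiples p N) \<le> N div p + 1" and "finite (multiples p N)"
proof -
  have "multiples p N \<subseteq> (\<lambda>j. int (p * j)) ` {..N div p}"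
  proof
    fix c assume "c \<in> multiples p N"
    then have c: "0 \<le> c" "c < int N" "int p dvd c"
      by (simp_all add: multiples_def)
    then have "p dvd nat c" by (simp add: nat_dvd_iff int_dvd_int_iff[symmetric] del: int_dvd_int_iff)
    then obtain d where "nat c = p * d" ..
    then have d: "c = int (p * d)" "c < int N" using c by linarith+
    then have "p * d < N" by (simp only: of_nat_less_iff)
    then have "d \<le> N div p"
      using assms by (simp add: less_eq_div_iff_mult_less_eq mult.commute)
    then show "c \<in> (\<lambda>j. int (p * j)) ` {..N div p}" using d by blast
  qed
  then show "card (multiples p N) \<le> N div p + 1" "finite (multiples p N)"
    using card_mono[of "(\<lambda>j. int (p * j)) ` {..N div p}" "multiples p N"]
      card_image_le[of "{..N div p}" "\<lambda>j. int (p * j)"]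
    by (auto intro: finite_subset)
qed

definition edge_columns :: "nat \<Rightarrow> nat \<Rightarrow> int set" where
  "edge_columns p m = {0..<int m} \<inter> ({0..<int p} \<union> {int m - int p..<int m})"

text \<open>Column \<open>m - 1\<close> is added because rounding up to a multiple of
  \<open>p\<close> may overshoot the last column.\<close>

definition spaced_columns :: "nat \<Rightarrow> nat \<Rightarrow> int set" where
  "spaced_columns p m = insert (int m - 1) (multiples p m)"

text \<open>Any \<open>p\<close> consecutive integers contain a multiple of \<open>p\<close>. The
  first block of edge columns serves \<open>y \<le> 0\<close>, the last block serves
  \<open>y > 0\<close>.\<close>

lemma edge_minus_spaced_columns:
  assumes p: "p > 0" and y: "\<bar>y\<bar> \<le> int m - 1"
  obtains a b where "a \<in> edge_columns p m" "b \<in> spaced_columns p m" "a - b = y"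
proof (cases "y \<le> 0")
  case True
  obtain c where c: "int p dvd c" "- y \<le> c" "c < - y + int p"
    using multiple_in_window[of "int p" "- y"] p by auto
  \<comment> \<open>Capping keeps \<open>b\<close> in the window, because
    \<open>- y \<le> m - 1\<close>.\<close>
  define b where "b = min c (int m - 1)"
  have "b \<in> spaced_columns p m" "b + y \<in> edge_columns p m"
    using c y True by (auto simp: b_def spaced_columns_def multiples_def edge_columns_def min_def)
  then show ?thesis using that[of "b + y" b] by simp
next
  case False
  obtain c where c: "int p dvd c" "int m - int p - y \<le> c" "c < int m - y"
    using multiple_in_window[of "int p" "int m - int p - y"] p by auto
  \<comment> \<open>The window starts at \<open>m - p - y \<ge> 1 - p\<close>, which lies above the
    largest negative multiple of \<open>p\<close>.\<close>
  have "c \<ge> 0"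
  proof (rule ccontr)
    assume "\<not> c \<ge> 0"
    then have "int p \<le> - c" using c(1) by (intro zdvd_imp_le) auto
    then show False using c y by linarith
  qed
  then have "c \<in> spaced_columns p m" "c + y \<in> edge_columns p m"
    using c y False by (auto simp: spaced_columns_def multiples_def edge_columns_def)
  then show ?thesis using that[of "c + y" c] by simp
qed

text \<open>Meant for two letters sharing one row: the bound \<open>p \<le> b\<close> keeps their
  columns disjoint. It holds since \<open>c\<close> is a positive multiple of \<open>p\<close> and
  \<open>p \<le> m - 1\<close> survives the capping.\<close>

lemma spaced_minus_initial_columns:
  assumes p: "p > 0" "p < m" and y: "0 < y" "y \<le> int m - 1"
  obtains a b where "a \<in> {0..<int p}" "b \<in> spaced_columns p m" "int p \<le> b" "b - a = y"
proof -
  obtain c where c: "int p dvd c" "y \<le> c" "c < y + int p"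
    using multiple_in_window[of "int p" y] p by auto
  then have "int p \<le> c" using y by (simp add: zdvd_imp_le)
  define b where "b = min c (int m - 1)"
  have "b \<in> spaced_columns p m" "int p \<le> b" "b - y \<in> {0..<int p}"
    using c y p \<open>int p \<le> c\<close> by (auto simp: b_def spaced_columns_def multiples_def min_def)
  then show ?thesis using that[of "b - y" b] by simp
qed

text \<open>Row \<open>n - q - 1\<close> is the last one above the \<open>q\<close> rows of the first letter; it yields the
  differences between \<open>1\<close> and \<open>q\<close>.\<close>

definition spaced_rows :: "nat \<Rightarrow> nat \<Rightarrow> int set" where
  "spaced_rows q n = insert (int n - int q - 1) (multiples q (n - q))"

lemma last_minus_spaced_rows:
  assumes q: "q > 0" "q < n" and x: "0 < x" "x \<le> int n - 1"
  obtains a b where "a \<in> {int n - int q..<int n}" "b \<in> spaced_rows q n" "a - b = x"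
proof (cases "x \<le> int q")
  case True
  then show ?thesis
    using that[of "int n - int q - 1 + x" "int n - int q - 1"] x by (auto simp: spaced_rows_def)
next
  case False
  \<comment> \<open>As \<open>x > q\<close>, the bound \<open>c < n - x\<close> puts
    \<open>c\<close> above the block of the last \<open>q\<close> rows.\<close>
  obtain c where c: "int q dvd c" "int n - int q - x \<le> c" "c < int n - x"
    using multiple_in_window[of "int q" "int n - int q - x"] q by auto
  have "c \<ge> 0"
  proof (rule ccontr)
    assume "\<not> c \<ge> 0"
    then have "int q \<le> - c" using c(1) by (intro zdvd_imp_le) auto
    then show False using c x by linarith
  qed
  then have "c \<in> spaced_rows q n" "c + x \<in> {int n - int q..<int n}"
    using c x q False by (auto simp: spaced_rows_def multiples_def)
  then show ?thesis using that[of "c + x" c] by simp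
qed

section \<open>The product construction\<close>

definition first_letter :: "nat \<Rightarrow> nat \<Rightarrow> nat \<Rightarrow> nat \<Rightarrow> (int \<times> int) set" where
  "first_letter q p n m =
     {int n - int q..<int n} \<times> edge_columns p m \<union> {1} \<times> {0..<int p}"

definition second_letter :: "nat \<Rightarrow> nat \<Rightarrow> nat \<Rightarrow> nat \<Rightarrow> (int \<times> int) set" where
  "second_letter q p n m =
     spaced_rows q n \<times> spaced_columns p m \<union> {1} \<times> (spaced_columns p m - {0..<int p})"

text \<open>The two coordinates of a product are chosen independently, which settles
  \<open>x > 0\<close>; negation settles \<open>x < 0\<close>. Row 1 supplies the vectors with
  \<open>x = 0\<close>.\<close>

lemma difference_cover_letters:
  assumes q: "q \<ge> 2" "q + 3 \<le> n" and p: "p > 0" "p \<le> m" "m > 1 \<Longrightarrow> p < m"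
  shows "difference_cover n m (first_letter q p n m) (second_letter q p n m)"
  unfolding difference_cover_def
proof (intro conjI allI impI)
  let ?A = "first_letter q p n m" and ?B = "second_letter q p n m"
  \<comment> \<open>Row 1 is free: it is no multiple of \<open>q \<ge> 2\<close>, and
    \<open>n - q - 1 \<ge> 2\<close>.\<close>
  have rows: "1 \<notin> spaced_rows q n" "spaced_rows q n \<subseteq> {0..<int n - int q}"
    using q by (auto simp: spaced_rows_def multiples_def)
  have cols: "spaced_columns p m \<subseteq> {0..<int m}" "edge_columns p m \<subseteq> {0..<int m}"
    using p by (auto simp: spaced_columns_def multiples_def edge_columns_def)
  show "?A \<subseteq> grid n m" "?B \<subseteq> grid n m"
    using rows cols q p by (auto simp: first_letter_def second_letter_def grid_def)
  show "?A \<inter> ?B = {}"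
    using rows q by (auto simp: first_letter_def second_letter_def)
  show "?A \<noteq> {}"
    using p by (auto simp: first_letter_def)
  have pos: "\<exists>a\<in>?A. \<exists>b\<in>?B. a - b = (x, y)"
    if xy: "0 < x" "x \<le> int n - 1" "\<bar>y\<bar> \<le> int m - 1" for x y
  proof -
    obtain a1 b1 where 1: "a1 \<in> {int n - int q..<int n}" "b1 \<in> spaced_rows q n" "a1 - b1 = x"
      by (rule last_minus_spaced_rows[of q n x]) (use xy q in auto)
    obtain a2 b2 where 2: "a2 \<in> edge_columns p m" "b2 \<in> spaced_columns p m" "a2 - b2 = y"
      by (rule edge_minus_spaced_columns[of p y m]) (use xy p in auto)
    show ?thesis
      using 1 2 by (intro bexI[of _ "(a1, a2)"] bexI[of _ "(b1, b2)"])
        (auto simp: first_letter_def second_letter_def)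
  qed
  \<comment> \<open>A positive \<open>y\<close> in range forces \<open>m > 1\<close>, hence
    \<open>p < m\<close>.\<close>
  have zero: "\<exists>a\<in>?A. \<exists>b\<in>?B. b - a = (0, y)" if y: "0 < y" "y \<le> int m - 1" for y
  proof -
    obtain a b where ab: "a \<in> {0..<int p}" "b \<in> spaced_columns p m" "int p \<le> b" "b - a = y"
      by (rule spaced_minus_initial_columns[of p m y]) (use y p in auto)
    show ?thesis
      using ab by (intro bexI[of _ "(1, a)"] bexI[of _ "(1, b)"])
        (auto simp: first_letter_def second_letter_def)
  qed
  have neg: "\<exists>a\<in>?A. \<exists>b\<in>?B. a - b = (x, y) \<or> b - a = (x, y)"
    if "\<exists>a\<in>?A. \<exists>b\<in>?B. a - b = (- x, - y) \<or> b - a = (- x, - y)" for x y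
  proof -
    have "- (x, y) = (- x, - y)" by simp
    then show ?thesis using that by (metis minus_diff_eq minus_minus)
  qed
  fix x y :: int
  assume xy: "(x, y) \<noteq> 0 \<and> \<bar>x\<bar> \<le> int n - 1 \<and> \<bar>y\<bar> \<le> int m - 1"
  then consider "0 < x" | "x < 0" | "x = 0" "0 < y" | "x = 0" "y < 0"
    by (metis linorder_neqE zero_prod_def)
  then show "\<exists>a\<in>?A. \<exists>b\<in>?B. a - b = (x, y) \<or> b - a = (x, y)"
  proof cases
    case 1
    then have "\<exists>a\<in>?A. \<exists>b\<in>?B. a - b = (x, y)" using xy by (intro pos) simp_all
    then show ?thesis by blast
  next
    case 2
    then have "\<exists>a\<in>?A. \<exists>b\<in>?B. a - b = (- x, - y)" using xy by (intro pos) simp_all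
    then show ?thesis by - (rule neg, blast)
  next
    case 3
    then have "\<exists>a\<in>?A. \<exists>b\<in>?B. b - a = (x, y)" using xy zero[of y] by simp
    then show ?thesis by blast
  next
    case 4
    then have "\<exists>a\<in>?A. \<exists>b\<in>?B. b - a = (- x, - y)" using xy zero[of "- y"] by simp
    then show ?thesis by - (rule neg, blast)
  qed
qed

text \<open>The leading terms \<open>2 * q * p\<close> and \<open>(n / q) * (m / p)\<close> have
  product \<open>2 * n * m\<close>, so their sum is smallest,
  \<open>2 * sqrt 2 * sqrt (n * m)\<close>, when they are equal.\<close>

lemma card_letters_le:
  assumes q: "0 < q" and p: "0 < p"
  shows "card (first_letter q p n m) + card (second_letter q p n m)
    \<le> q * (2 * p) + p + (n div q + 2) * (m div p + 2) + (m div p + 2)"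
proof -
  have "card (edge_columns p m) \<le> card ({0..<int p} \<union> {int m - int p..<int m})"
    by (intro card_mono) (auto simp: edge_columns_def)
  also have "\<dots> \<le> 2 * p"
    using card_Un_le[of "{0..<int p}" "{int m - int p..<int m}"] by simp
  finally have edge: "card (edge_columns p m) \<le> 2 * p" .
  have "card (first_letter q p n m)
      \<le> card ({int n - int q..<int n} \<times> edge_columns p m) + card ({1 :: int} \<times> {0..<int p})"
    unfolding first_letter_def by (rule card_Un_le)
  also have "\<dots> \<le> q * (2 * p) + p"
    using edge by (simp add: card_cartesian_product)
  finally have A: "card (first_letter q p n m) \<le> q * (2 * p) + p" .
  have cols: "card (spaced_columns p m) \<le> m div p + 2" "finite (spaced_columns p m)"
    using card_multiples_le[OF p, of m] card_insert_le_m1[of "m div p + 2" "multiples p m" "int m - 1"]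
    by (auto simp: spaced_columns_def)
  have "(n - q) div q \<le> n div q"
    by (simp add: div_le_mono)
  then have rows: "card (spaced_rows q n) \<le> n div q + 2"
    using card_multiples_le[OF q, of "n - q"]
      card_insert_le_m1[of "n div q + 2" "multiples q (n - q)" "int n - int q - 1"]
    by (auto simp: spaced_rows_def)
  have "card (second_letter q p n m)
      \<le> card (spaced_rows q n \<times> spaced_columns p m)
        + card ({1 :: int} \<times> (spaced_columns p m - {0..<int p}))"
    unfolding second_letter_def by (rule card_Un_le)
  also have "\<dots> \<le> (n div q + 2) * (m div p + 2) + (m div p + 2)"
    using mult_le_mono[OF rows cols(1)] cols
      card_mono[OF cols(2), of "spaced_columns p m - {0..<int p}"]
    by (simp add: card_cartesian_product)
  finally show ?thesis using A by linarith
qed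

section \<open>Choice of \<open>q\<close> and \<open>p\<close>, and the error term\<close>

lemma div_floor_sqrt_le: "n div floor_sqrt n \<le> floor_sqrt n + 2"
proof (cases "n = 0")
  case False
  define s where "s = floor_sqrt n"
  have s: "s > 0" using False by (simp add: s_def)
  have "n < (Suc s)\<^sup>2" unfolding s_def by (rule Suc_floor_sqrt_power2_gt)
  then have "n \<le> s * (s + 2)" by (simp add: power2_eq_square algebra_simps)
  then have "n div s \<le> s * (s + 2) div s" by (rule div_le_mono)
  then show ?thesis using s by (simp add: s_def)
qed simp

lemma small_difference_cover:
  assumes n: "n \<ge> 8" and m: "m \<ge> 1"
  obtains A B where "difference_cover n m A B"
    "real (card A + card B)
       \<le> 2 * sqrt 2 * sqrt (real n * real m) + 25 * (sqrt (real n) + sqrt (real m))"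
proof -
  define q where "q = floor_sqrt (n div 2)"
  define p where "p = floor_sqrt m"
  have qq: "q\<^sup>2 \<le> n div 2" and pp: "p\<^sup>2 \<le> m"
    by (simp_all add: q_def p_def)
  have "floor_sqrt (2\<^sup>2) \<le> q"
    unfolding q_def using n by (intro mono_floor_sqrt') auto
  then have q2: "q \<ge> 2" by (simp only: floor_sqrt_inverse_power2)
  have "2 * q \<le> q\<^sup>2" using q2 by (simp add: power2_eq_square)
  then have qn: "q + 3 \<le> n" using qq n by linarith
  have p0: "p > 0" using m by (simp add: p_def)
  have pm: "p \<le> m" using pp p0 by (metis le_square order_trans power2_eq_square)
  have pm': "p < m" if "m > 1"
  proof (rule ccontr)
    assume "\<not> p < m"
    then have "p = m" using pm by simp
    then have "m * m \<le> m * 1" using pp by (simp add: power2_eq_square)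
    then show False using that by simp
  qed
  have divp: "m div p \<le> p + 2"
    unfolding p_def by (rule div_floor_sqrt_le)
  have divq: "n div q \<le> 2 * q + 5"
  proof -
    have "n div 2 < (Suc q)\<^sup>2" unfolding q_def by (rule Suc_floor_sqrt_power2_gt)
    then have "n div 2 \<le> q * q + 2 * q" by (simp add: power2_eq_square)
    \<comment> \<open>Halving loses at most 1, so \<open>n \<le> 2 * q * q + 4 * q + 1\<close>, and
      the 1 is absorbed by another \<open>q\<close>.\<close>
    then have "n \<le> q * (2 * q + 5)" using q2 by (simp add: algebra_simps)
    then have "n div q \<le> q * (2 * q + 5) div q" by (rule div_le_mono)
    then show ?thesis using q2 by simp
  qed
  have "card (first_letter q p n m) + card (second_letter q p n m)
      \<le> q * (2 * p) + p + (n div q + 2) * (m div p + 2) + (m div p + 2)"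
    using q2 p0 by (intro card_letters_le) auto
  also have "\<dots> \<le> q * (2 * p) + p + (2 * q + 7) * (p + 4) + (p + 4)"
  proof -
    have "n div q + 2 \<le> 2 * q + 7" "m div p + 2 \<le> p + 4" using divp divq by linarith+
    then show ?thesis using mult_le_mono by (metis add_le_mono order_refl)
  qed
  also have "\<dots> = 4 * (q * p) + 8 * q + 9 * p + 32"
    by (simp add: algebra_simps)
  finally have card: "real (card (first_letter q p n m) + card (second_letter q p n m))
      \<le> 4 * (real q * real p) + 8 * real q + 9 * real p + 32"
    using of_nat_mono[where 'a = real] by fastforce
  have "2 * q\<^sup>2 \<le> n" using qq by simp
  then have "real (2 * q\<^sup>2) \<le> real n" by (simp only: of_nat_le_iff)
  then have rq: "2 * (real q)\<^sup>2 \<le> real n" by simp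
  have rp: "(real p)\<^sup>2 \<le> real m" using pp by (simp flip: of_nat_power)
  have sq: "sqrt 2 * real q \<le> sqrt (real n)"
    by (rule real_le_rsqrt) (use rq in \<open>simp add: power_mult_distrib\<close>)
  have sp: "real p \<le> sqrt (real m)" by (rule real_le_rsqrt[OF rp])
  have sq': "real q \<le> sqrt (real n)"
    by (rule real_le_rsqrt) (use rq zero_le_power2[of "real q"] in linarith)
  have "(sqrt 2 * real q) * real p \<le> sqrt (real n) * sqrt (real m)"
    using sq sp by (intro mult_mono) auto
  then have "2 * sqrt 2 * ((sqrt 2 * real q) * real p) \<le> 2 * sqrt 2 * sqrt (real n * real m)"
    by (simp add: real_sqrt_mult)
  moreover have "2 * sqrt 2 * ((sqrt 2 * real q) * real p) = 4 * (real q * real p)"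
    by simp
  \<comment> \<open>The constant 32 splits into 16 for each root, so the coefficients are at most
    \<open>8 + 16\<close> and \<open>9 + 16 = 25\<close>.\<close>
  moreover have "1 \<le> sqrt (real n)" "1 \<le> sqrt (real m)" using n m by simp_all
  ultimately have "real (card (first_letter q p n m) + card (second_letter q p n m))
      \<le> 2 * sqrt 2 * sqrt (real n * real m) + 25 * (sqrt (real n) + sqrt (real m))"
    using card sq' sp by (simp only: distrib_left)
  then show ?thesis
    using that difference_cover_letters[OF q2 qn p0 pm pm'] by blast
qed

theorem theorem11:
  "\<exists>C::real. C > 0 \<and>
     (\<forall>k n m :: nat. k \<ge> 2 \<longrightarrow> n \<ge> 1 \<longrightarrow> m \<ge> 1 \<longrightarrow>
        real n * real m - 2 * sqrt 2 * sqrt (real n * real m) - C * (sqrt (real n) + sqrt (real m))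
          \<le> real (HB2 k n m))"
proof (intro exI[of _ 25] conjI allI impI)
  fix k n m :: nat
  assume k: "k \<ge> 2" and n: "n \<ge> 1" and m: "m \<ge> 1"
  let ?e = "2 * sqrt 2 * sqrt (real n * real m) + 25 * (sqrt (real n) + sqrt (real m))"
  have "real n * real m \<le> real (HB2 k n m) + ?e"
  proof (cases "n \<ge> 8 \<or> m \<ge> 8")
    case True
    obtain A B where AB: "difference_cover n m A B" "real (card A + card B) \<le> ?e"
    proof (cases "n \<ge> 8")
      case True
      then show ?thesis using small_difference_cover[OF _ m] that by blast
    next
      case False
      then obtain A B where AB: "difference_cover m n A B"
        "real (card A + card B)
          \<le> 2 * sqrt 2 * sqrt (real m * real n) + 25 * (sqrt (real m) + sqrt (real n))"
        using small_difference_cover[OF _ n] True by blast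
      have "card (prod.swap ` A) = card A" "card (prod.swap ` B) = card B"
        by (simp_all add: card_image)
      then show ?thesis
        using that[OF difference_cover_swap[OF AB(1)]] AB(2) by (simp add: mult.commute add.commute)
    qed
    have "real (n * m) \<le> real (HB2 k n m + card A + card B)"
      using HB2_ge_of_difference_cover[OF AB(1) k] by (simp only: of_nat_le_iff)
    then show ?thesis using AB(2) by simp
  next
    case False
    \<comment> \<open>On small grids the error term is at least 50 and exceeds \<open>n * m\<close>,
      so the bound holds whatever natural number \<open>HB2\<close> is, even an unspecified
      one.\<close>
    then have "n * m \<le> 7 * 7" by (intro mult_le_mono) auto
    then have "real (n * m) \<le> 49" by linarith
    then have "real n * real m \<le> 49" by simp
    moreover have "1 \<le> sqrt (real n)" "1 \<le> sqrt (real m)" "0 \<le> 2 * sqrt 2 * sqrt (real n * real m)"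
      using n m by simp_all
    ultimately show ?thesis by (simp only: distrib_left)
  qed
  then show "real n * real m - 2 * sqrt 2 * sqrt (real n * real m)
      - 25 * (sqrt (real n) + sqrt (real m)) \<le> real (HB2 k n m)"
    by simp
qed simp

end
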